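(* Let $\psi:\mathbb{R}^n\to(0,\infty)$ be a strictly positive log-concave function which vanishes at infinity. Then for any positive finite Borel measure $\mu$ on $\mathbb{R}^n$ and any $p\ge 1$ the quantity $$Q(t)=\int_{\mathbb{R}^n}\left(\int_{\mathbb{R}^n}\psi(x-vt)\,d\mu(v)\right)^p\,dx$$ is non-increasing in $t$ for $t\ge 0$.
   Context: Log-concave means that $\log\psi$ is a concave function; vanishing at infinity means $\psi(x)\to 0$ as $|x|\to\infty$. *)

theory Defs
  imports "HOL-Analysis.Analysis"
begin

(* Meant for strictly positive functions only, where ln is the genuine logarithm. *)
definition log_concave :: "('a::real_vector \<Rightarrow> real) \<Rightarrow> bool"
  where "log_concave \<psi> \<longleftrightarrow> concave_on UNIV (\<lambda>x. ln (\<psi> x))"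

(* The outer integral takes values in [0, \<infinity>], so no value is lost if it diverges.
   The inner one is real-valued: it is only used for \<psi> positive and log-concave (hence
   continuous), vanishing at infinity (hence bounded) and for M a finite Borel measure, so
   that the integrand is bounded and measurable and therefore integrable. *)
definition Q :: "(real^'n \<Rightarrow> real) \<Rightarrow> (real^'n) measure \<Rightarrow> real \<Rightarrow> real \<Rightarrow> ennreal"
  where "Q \<psi> M p t = (\<integral>\<^sup>+x. ennreal ((\<integral>v. \<psi> (x - t *\<^sub>R v) \<partial>M) powr p) \<partial>lborel)"

end

theory Submission
  imports Defs
begin

text \<open>
  Write \<open>f\<^sub>t(x) = \<integral> \<psi>(x - tv) d\<mu>(v)\<close> and \<open>p = 1 + q\<close>. For \<open>0 \<le> s < t\<close>, expand one of the \<open>p\<close>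
  factors of \<open>f\<^sub>s\<^sup>p\<close> as an integral over \<open>v\<close> and, for each fixed \<open>v\<close>, translate \<open>x\<close> by
  \<open>(t - s)v\<close>. By Tonelli's theorem, \<open>Q(s)\<close> is the integral over \<open>x\<close> of
  \<open>\<integral> \<psi>(x - tv) f\<^sub>s(x - (t - s)v)\<^sup>q d\<mu>(v)\<close>.

  The translation aligns the two times. With \<open>\<theta> = (t - s)/t\<close>, the argument of \<open>\<psi>\<close> inside \<open>f\<^sub>s\<close>
  is a convex combination of points that occur at time \<open>t\<close>:
  \<open>x - (t - s)v - sw = (1 - \<theta>)(x - tw) + \<theta>(x - tv)\<close>. By log-concavity, the value of \<open>\<psi>\<close> there is at
  least \<open>u(w)\<^bsup>1 - \<theta>\<^esup> u(v)\<^bsup>\<theta>\<^esup>\<close>, where \<open>u(v) = \<psi>(x - tv)\<close> for fixed \<open>x\<close>. Hence the integrand in \<open>x\<close> is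
  at least \<open>(\<integral> u\<^bsup>1 + \<theta>q\<^esup> d\<mu>) (\<integral> u\<^bsup>1 - \<theta>\<^esup> d\<mu>)\<^sup>q\<close>. Since \<open>1\<close> is the average of the exponents
  \<open>1 + \<theta>q\<close> and \<open>1 - \<theta>\<close> with weights \<open>1/p\<close> and \<open>q/p\<close>, Hoelder's inequality bounds this product
  from below by \<open>(\<integral> u d\<mu>)\<^bsup>1 + q\<^esup> = f\<^sub>t(x)\<^sup>p\<close> (lemma \<open>moment_interpolation\<close>). So after the
  translation, \<open>Q(s)\<close> and \<open>Q(t)\<close> compare pointwise in \<open>x\<close> (lemma
  \<open>integral_powr_le_kernel_integral\<close>).

  Continuity of \<open>\<psi>\<close>, from log-concavity, and its boundedness, as it also vanishes at infinity,
  make all integrals against \<open>\<mu>\<close> finite, so that inequalities between real integrals may be used.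
\<close>

section \<open>Hoelder's inequality and interpolation of moments\<close>

lemma integral_pos_of_pos:
  fixes f :: "'a \<Rightarrow> real"
  assumes "integrable M f" "\<And>x. f x > 0" "emeasure M (space M) \<noteq> 0"
  shows "(\<integral>x. f x \<partial>M) > 0"
proof -
  have "(\<integral>x. f x \<partial>M) \<noteq> 0"
  proof
    assume "(\<integral>x. f x \<partial>M) = 0"
    then have "AE x in M. f x = 0"
      using integral_nonneg_eq_0_iff_AE[OF assms(1)] assms(2) by (simp add: less_imp_le)
    then have "AE x in M. False"
      using assms(2) by (simp add: less_le)
    then show False
      using assms(3) by (simp add: ae_filter_eq_bot_iff trivial_limit_def[symmetric])
  qed
  moreover have "(\<integral>x. f x \<partial>M) \<ge> 0"
    using assms(2) by (simp add: less_imp_le)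
  ultimately show ?thesis by simp
qed

text \<open>Normalising \<open>f\<close> and \<open>g\<close> to integral one reduces Hoelder's inequality to the pointwise
  inequality of weighted arithmetic and geometric means. This form, rather than the one with
  conjugate exponents, includes the endpoints \<open>\<alpha> = 0\<close> and \<open>\<beta> = 0\<close>.\<close>

lemma Hoelder_integral_powr:
  fixes f g :: "'a \<Rightarrow> real"
  assumes f: "integrable M f" "\<And>x. f x > 0" and g: "integrable M g" "\<And>x. g x > 0"
    and weights: "0 \<le> \<alpha>" "0 \<le> \<beta>" "\<alpha> + \<beta> = 1"
  shows "(\<integral>x. f x powr \<alpha> * g x powr \<beta> \<partial>M) \<le> (\<integral>x. f x \<partial>M) powr \<alpha> * (\<integral>x. g x \<partial>M) powr \<beta>"
proof (cases "emeasure M (space M) = 0")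
  case True
  then have "AE x in M. False"
    by (auto intro: AE_I[of _ _ "space M"])
  then have "AE x in M. f x powr \<alpha> * g x powr \<beta> = 0"
    by eventually_elim simp
  then show ?thesis
    by (simp add: integral_eq_zero_AE)
next
  case False
  define A B where "A = (\<integral>x. f x \<partial>M)" and "B = (\<integral>x. g x \<partial>M)"
  have pos: "A > 0" "B > 0"
    using integral_pos_of_pos f g False unfolding A_def B_def by blast+
  define c where "c = A powr \<alpha> * B powr \<beta>"
  have c: "c > 0"
    unfolding c_def using pos by simp
  have amgm: "f x powr \<alpha> * g x powr \<beta> \<le> c * (\<alpha> * (f x / A) + \<beta> * (g x / B))" for x
  proof -
    have "(f x / A) powr \<alpha> * (g x / B) powr \<beta> \<le> \<alpha> * (f x / A) + \<beta> * (g x / B)"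
      using f(2)[of x] g(2)[of x] pos by (intro Youngs_inequality_0 weights) auto
    moreover have "f x powr \<alpha> * g x powr \<beta> = c * ((f x / A) powr \<alpha> * (g x / B) powr \<beta>)"
      using f(2)[of x] g(2)[of x] pos by (simp add: c_def powr_divide)
    ultimately show ?thesis
      using c by simp
  qed
  have "(\<integral>x. f x powr \<alpha> * g x powr \<beta> \<partial>M) \<le> (\<integral>x. c * (\<alpha> * (f x / A) + \<beta> * (g x / B)) \<partial>M)"
    by (rule integral_mono') (use f g amgm weights c pos in \<open>auto simp: less_imp_le\<close>)
  also have "\<dots> = c * (\<alpha> * (A / A) + \<beta> * (B / B))"
    using f g by (simp add: A_def B_def)
  also have "\<dots> = c"
    using pos weights by simp
  finally show ?thesis
    by (simp add: c_def A_def B_def)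
qed

lemma (in finite_measure) integrable_bounded_powr:
  fixes u :: "'a \<Rightarrow> real"
  assumes "u \<in> borel_measurable M" "\<And>v. u v > 0" "\<And>v. u v \<le> C" "r \<ge> 0"
  shows "integrable M (\<lambda>v. u v powr r)"
  by (rule integrable_const_bound[where B = "C powr r"])
    (use assms in \<open>auto intro!: AE_I2 powr_mono2 simp: less_imp_le\<close>)

text \<open>The exponent \<open>1\<close> is the convex combination of \<open>1 + \<theta> * q\<close> and \<open>1 - \<theta>\<close> with weights
  \<open>1 / (1 + q)\<close> and \<open>q / (1 + q)\<close>, so this is Hoelder's inequality raised to the power \<open>1 + q\<close>.\<close>

lemma (in finite_measure) moment_interpolation:
  fixes u :: "'a \<Rightarrow> real"
  assumes u: "u \<in> borel_measurable M" "\<And>v. u v > 0" "\<And>v. u v \<le> C"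
    and "0 \<le> \<theta>" "\<theta> \<le> 1" "0 \<le> q"
  shows "(\<integral>v. u v \<partial>M) powr (1 + q)
    \<le> (\<integral>v. u v powr (1 + \<theta> * q) \<partial>M) * (\<integral>v. u v powr (1 - \<theta>) \<partial>M) powr q"
proof -
  let ?A = "\<integral>v. u v powr (1 + \<theta> * q) \<partial>M" and ?B = "\<integral>v. u v powr (1 - \<theta>) \<partial>M"
  define \<alpha> \<beta> where "\<alpha> = 1 / (1 + q)" and "\<beta> = q / (1 + q)"
  have weights: "0 \<le> \<alpha>" "0 \<le> \<beta>" "\<alpha> + \<beta> = 1" and \<alpha>: "\<alpha> * (1 + q) = 1" and \<beta>: "\<beta> * (1 + q) = q"
    using \<open>0 \<le> q\<close> by (simp_all add: \<alpha>_def \<beta>_def add_divide_distrib[symmetric])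
  have exponent: "(1 + \<theta> * q) * \<alpha> + (1 - \<theta>) * \<beta> = 1"
    using \<open>0 \<le> q\<close> by (simp add: \<alpha>_def \<beta>_def add_divide_distrib[symmetric] algebra_simps)
  have "u v = (u v powr (1 + \<theta> * q)) powr \<alpha> * (u v powr (1 - \<theta>)) powr \<beta>" for v
    using u(2)[of v] by (simp add: powr_powr powr_add[symmetric] exponent)
  then have "(\<integral>v. u v \<partial>M)
      = (\<integral>v. (u v powr (1 + \<theta> * q)) powr \<alpha> * (u v powr (1 - \<theta>)) powr \<beta> \<partial>M)"
    by simp
  also have "\<dots> \<le> ?A powr \<alpha> * ?B powr \<beta>"
    using assms u(2)
    by (intro Hoelder_integral_powr integrable_bounded_powr weights) (auto simp: less_le)
  finally have "(\<integral>v. u v \<partial>M) powr (1 + q) \<le> (?A powr \<alpha> * ?B powr \<beta>) powr (1 + q)"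
    using u(2) \<open>0 \<le> q\<close> by (intro powr_mono2 integral_nonneg) (auto simp: less_imp_le)
  also have "\<dots> = ?A powr 1 * ?B powr q"
    by (simp add: powr_mult powr_powr \<alpha> \<beta>)
  also have "\<dots> = ?A * ?B powr q"
    by simp
  finally show ?thesis .
qed

text \<open>The comparison at a fixed \<open>x\<close>, where \<open>K v w\<close> is the value of \<open>\<psi>\<close> at a point between
  those where \<open>\<psi>\<close> takes the values \<open>u v\<close> and \<open>u w\<close>. The lower bound on \<open>K\<close> separates
  \<open>v\<close> from \<open>w\<close>, so it bounds the right-hand side by a product of two moments of \<open>u\<close>.\<close>

lemma (in finite_measure) integral_powr_le_kernel_integral:
  fixes u :: "'a \<Rightarrow> real" and K :: "'a \<Rightarrow> 'a \<Rightarrow> real"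
  assumes u: "u \<in> borel_measurable M" "\<And>v. u v > 0" "\<And>v. u v \<le> C"
    and K: "\<And>v. integrable M (K v)"
    and lower: "\<And>v w. u w powr (1 - \<theta>) * u v powr \<theta> \<le> K v w"
    and int: "integrable M (\<lambda>v. u v * (\<integral>w. K v w \<partial>M) powr q)"
    and "0 \<le> \<theta>" "\<theta> \<le> 1" "0 \<le> q"
  shows "(\<integral>v. u v \<partial>M) powr (1 + q) \<le> (\<integral>v. u v * (\<integral>w. K v w \<partial>M) powr q \<partial>M)"
proof -
  let ?B = "\<integral>w. u w powr (1 - \<theta>) \<partial>M"
  have B: "?B \<ge> 0"
    by simp
  have le: "u v powr (1 + \<theta> * q) * ?B powr q \<le> u v * (\<integral>w. K v w \<partial>M) powr q" for v
  proof -
    have "?B * u v powr \<theta> = (\<integral>w. u w powr (1 - \<theta>) * u v powr \<theta> \<partial>M)"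
      by simp
    also have "\<dots> \<le> (\<integral>w. K v w \<partial>M)"
      by (intro integral_mono integrable_mult_left integrable_bounded_powr K lower) (use assms in auto)
    finally have "(?B * u v powr \<theta>) powr q \<le> (\<integral>w. K v w \<partial>M) powr q"
      using B \<open>0 \<le> q\<close> by (intro powr_mono2) auto
    moreover have "u v powr (1 + \<theta> * q) * ?B powr q = u v * (?B * u v powr \<theta>) powr q"
      using B u(2)[of v] by (simp add: powr_mult powr_powr powr_add)
    ultimately show ?thesis
      using u(2)[of v] by simp
  qed
  have "(\<integral>v. u v \<partial>M) powr (1 + q) \<le> (\<integral>v. u v powr (1 + \<theta> * q) \<partial>M) * ?B powr q"
    by (rule moment_interpolation) (use assms in auto)
  also have "\<dots> = (\<integral>v. u v powr (1 + \<theta> * q) * ?B powr q \<partial>M)"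
    by simp
  also have "\<dots> \<le> (\<integral>v. u v * (\<integral>w. K v w \<partial>M) powr q \<partial>M)"
    by (intro integral_mono int le integrable_mult_left integrable_bounded_powr) (use assms in auto)
  finally show ?thesis .
qed

section \<open>Log-concave functions vanishing at infinity\<close>

lemma log_concave_powr:
  assumes "log_concave \<psi>" "\<And>x. \<psi> x > 0" "0 \<le> \<theta>" "\<theta> \<le> 1"
  shows "\<psi> x powr (1 - \<theta>) * \<psi> y powr \<theta> \<le> \<psi> ((1 - \<theta>) *\<^sub>R x + \<theta> *\<^sub>R y)"
proof -
  have "(1 - \<theta>) * ln (\<psi> x) + \<theta> * ln (\<psi> y) \<le> ln (\<psi> ((1 - \<theta>) *\<^sub>R x + \<theta> *\<^sub>R y))"
    using assms by (intro concave_onD) (auto simp: log_concave_def)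
  then have "exp ((1 - \<theta>) * ln (\<psi> x) + \<theta> * ln (\<psi> y)) \<le> \<psi> ((1 - \<theta>) *\<^sub>R x + \<theta> *\<^sub>R y)"
    using assms(2) by (simp add: ln_ge_iff)
  then show ?thesis
    using assms(2)[of x] assms(2)[of y] by (simp add: powr_def exp_add)
qed

lemma log_concave_continuous:
  fixes \<psi> :: "'a::euclidean_space \<Rightarrow> real"
  assumes "log_concave \<psi>" "\<And>x. \<psi> x > 0"
  shows "continuous_on UNIV \<psi>"
proof -
  have "continuous_on UNIV (\<lambda>x. - ln (\<psi> x))"
    using assms(1) by (intro convex_on_continuous) (auto simp: log_concave_def concave_on_def)
  then have "continuous_on UNIV (\<lambda>x. exp (- (- ln (\<psi> x))))"
    by (rule continuous_on_exp[OF continuous_on_minus])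
  then show ?thesis
    using assms(2) by simp
qed

lemma continuous_vanishing_bounded_above:
  fixes \<psi> :: "'a::euclidean_space \<Rightarrow> real"
  assumes "continuous_on UNIV \<psi>" "(\<psi> \<longlongrightarrow> 0) at_infinity"
  obtains C where "\<And>x. \<psi> x \<le> C"
proof -
  have "eventually (\<lambda>x. \<psi> x < 1) at_infinity"
    using assms(2) by (rule order_tendstoD) simp
  then obtain R where R: "\<And>x. norm x \<ge> R \<Longrightarrow> \<psi> x < 1"
    by (auto simp: eventually_at_infinity)
  have "compact (\<psi> ` cball 0 R)"
    using assms(1) by (intro compact_continuous_image continuous_on_subset[OF assms(1)]) auto
  then obtain B where B: "\<And>x. x \<in> cball 0 R \<Longrightarrow> \<psi> x \<le> B"
    using bounded_imp_bdd_above compact_imp_bounded by (metis bdd_above.E imageI)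
  have "\<psi> x \<le> max 1 B" for x
    using R[of x] B[of x] by (cases "norm x \<le> R") (auto simp: max_def less_imp_le)
  then show ?thesis
    using that by blast
qed

section \<open>Monotonicity of the functional\<close>

lemma nn_integral_lborel_translate:
  fixes F :: "'a::euclidean_space \<Rightarrow> ennreal"
  assumes "F \<in> borel_measurable borel"
  shows "(\<integral>\<^sup>+x. F x \<partial>lborel) = (\<integral>\<^sup>+x. F (c + x) \<partial>lborel)"
proof -
  have "(\<integral>\<^sup>+x. F x \<partial>lborel) = (\<integral>\<^sup>+x. F x \<partial>distr lborel borel ((+) c))"
    by (simp add: lborel_distr_plus)
  also have "\<dots> = (\<integral>\<^sup>+x. F (c + x) \<partial>lborel)"
    using assms by (subst nn_integral_distr) auto
  finally show ?thesis .
qed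

theorem lemma10p4:
  fixes \<psi> :: "real^'n \<Rightarrow> real"
    and M :: "(real^'n) measure"
    and p :: real
  assumes "\<And>x. \<psi> x > 0"
    and "log_concave \<psi>"
    and "(\<psi> \<longlongrightarrow> 0) at_infinity"
    and "finite_measure M" and "sets M = sets borel"
    and "p \<ge> 1"
  shows "antimono_on {0..} (Q \<psi> M p)"
proof (rule monotone_onI)
  fix s t :: real
  assume st: "s \<in> {0..}" "t \<in> {0..}" "s \<le> t"
  interpret finite_measure M by fact
  interpret P: pair_sigma_finite "lborel :: (real^'n) measure" M ..
  note pos = assms(1)
  have cont: "continuous_on UNIV \<psi>"
    using assms(1,2) by (intro log_concave_continuous)
  note [measurable_cong] = assms(5)
  have [measurable]: "\<psi> \<in> borel_measurable borel"
    using cont by (rule borel_measurable_continuous_onI)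
  obtain C where C: "\<And>x. \<psi> x \<le> C"
    using continuous_vanishing_bounded_above[OF cont assms(3)] by blast
  have int: "integrable M (\<lambda>v. \<psi> (a - r *\<^sub>R v))" for a r
    by (rule integrable_const_bound[where B = C]) (use C pos in \<open>auto simp: less_imp_le\<close>)
  define f where "f r x = (\<integral>v. \<psi> (x - r *\<^sub>R v) \<partial>M)" for r x
  have [measurable]: "f r \<in> borel_measurable borel" for r
    unfolding f_def by measurable
  have f_nonneg: "f r x \<ge> 0" for r x
    unfolding f_def using pos by (simp add: less_imp_le)
  define D where "D = C * measure M (space M)"
  have f_le: "f r x \<le> D" for r x
  proof -
    have "f r x \<le> (\<integral>v. C \<partial>M)"
      unfolding f_def using C by (intro integral_mono int) auto
    then show ?thesis
      by (simp add: D_def mult.commute)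
  qed
  define q where "q = p - 1"
  have q: "q \<ge> 0" "p = 1 + q"
    using assms(6) by (simp_all add: q_def)
  \<comment> \<open>The integrand of \<open>Q(s)\<close> after the translation of \<open>x\<close> by \<open>(t - s)v\<close>.\<close>
  define h where "h x v = \<psi> (x - t *\<^sub>R v) * f s (x - (t - s) *\<^sub>R v) powr q" for x v
  have h_nonneg: "h x v \<ge> 0" for x v
    using pos by (simp add: h_def less_imp_le)
  have h_int: "integrable M (h x)" for x
  proof (rule integrable_const_bound[where B = "C * D powr q"])
    show "AE v in M. norm (h x v) \<le> C * D powr q"
      using C pos f_nonneg f_le q(1) order_trans[OF less_imp_le[OF pos] C]
      by (auto simp: h_def abs_mult less_imp_le intro!: mult_mono powr_mono2)
    show "h x \<in> borel_measurable M"
      unfolding h_def by measurable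
  qed

  have "Q \<psi> M p s = (\<integral>\<^sup>+x. (\<integral>\<^sup>+v. ennreal (\<psi> (x - s *\<^sub>R v) * f s x powr q) \<partial>M) \<partial>lborel)"
  proof -
    have "ennreal (f s x powr p) = (\<integral>\<^sup>+v. ennreal (\<psi> (x - s *\<^sub>R v) * f s x powr q) \<partial>M)" for x
    proof -
      have "f s x powr p = f s x * f s x powr q"
        unfolding q(2) using f_nonneg by (simp add: powr_mult_base)
      also have "\<dots> = (\<integral>v. \<psi> (x - s *\<^sub>R v) * f s x powr q \<partial>M)"
        by (simp add: f_def)
      finally show ?thesis
        using int pos by (simp add: nn_integral_eq_integral less_imp_le)
    qed
    then show ?thesis
      by (simp add: Q_def f_def)
  qed
  also have "\<dots> = (\<integral>\<^sup>+v. (\<integral>\<^sup>+x. ennreal (\<psi> (x - s *\<^sub>R v) * f s x powr q) \<partial>lborel) \<partial>M)"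
    by (intro P.Fubini'[symmetric]) measurable
  also have "\<dots> = (\<integral>\<^sup>+v. (\<integral>\<^sup>+x. ennreal (h x v) \<partial>lborel) \<partial>M)"
  proof (rule nn_integral_cong)
    fix v
    have "(\<integral>\<^sup>+x. ennreal (\<psi> (x - s *\<^sub>R v) * f s x powr q) \<partial>lborel)
      = (\<integral>\<^sup>+x. ennreal (\<psi> ((- (t - s) *\<^sub>R v + x) - s *\<^sub>R v)
            * f s (- (t - s) *\<^sub>R v + x) powr q) \<partial>lborel)"
      by (rule nn_integral_lborel_translate) measurable
    also have "\<dots> = (\<integral>\<^sup>+x. ennreal (h x v) \<partial>lborel)"
      by (simp add: h_def algebra_simps)
    finally show "(\<integral>\<^sup>+x. ennreal (\<psi> (x - s *\<^sub>R v) * f s x powr q) \<partial>lborel)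
      = (\<integral>\<^sup>+x. ennreal (h x v) \<partial>lborel)" .
  qed
  also have "\<dots> = (\<integral>\<^sup>+x. (\<integral>\<^sup>+v. ennreal (h x v) \<partial>M) \<partial>lborel)"
    unfolding h_def by (intro P.Fubini') measurable
  finally have Qs: "Q \<psi> M p s = (\<integral>\<^sup>+x. (\<integral>\<^sup>+v. ennreal (h x v) \<partial>M) \<partial>lborel)" .

  \<comment> \<open>If \<open>t = 0\<close>, division by zero gives \<open>\<theta> = 0\<close>; then \<open>s = 0\<close> too, so \<open>\<theta> * t = t - s\<close> holds.\<close>
  define \<theta> where "\<theta> = (t - s) / t"
  have \<theta>: "0 \<le> \<theta>" "\<theta> \<le> 1" "\<theta> * t = t - s"
    using st by (auto simp: \<theta>_def divide_simps)
  have pointwise: "f t x powr p \<le> (\<integral>v. h x v \<partial>M)" for x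
  proof -
    have lower: "\<psi> (x - t *\<^sub>R w) powr (1 - \<theta>) * \<psi> (x - t *\<^sub>R v) powr \<theta>
        \<le> \<psi> (x - (t - s) *\<^sub>R v - s *\<^sub>R w)" for v w
    proof -
      have s: "s = (1 - \<theta>) * t"
        using \<theta>(3) by (simp add: algebra_simps)
      have "x - (t - s) *\<^sub>R v - s *\<^sub>R w = (1 - \<theta>) *\<^sub>R (x - t *\<^sub>R w) + \<theta> *\<^sub>R (x - t *\<^sub>R v)"
        unfolding s by (simp add: algebra_simps)
      then show ?thesis
        using log_concave_powr[OF assms(2) pos \<theta>(1,2)] by metis
    qed
    have "integrable M
        (\<lambda>v. \<psi> (x - t *\<^sub>R v) * (\<integral>w. \<psi> (x - (t - s) *\<^sub>R v - s *\<^sub>R w) \<partial>M) powr q)"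
      using h_int[of x] unfolding h_def[abs_def] f_def .
    then show ?thesis
      unfolding q(2) h_def f_def
      using pos C int lower \<theta>(1,2) q(1)
      by (intro integral_powr_le_kernel_integral[where C = C and \<theta> = \<theta>]) simp_all
  qed
  have "Q \<psi> M p t = (\<integral>\<^sup>+x. ennreal (f t x powr p) \<partial>lborel)"
    by (simp add: Q_def f_def)
  also have "\<dots> \<le> (\<integral>\<^sup>+x. ennreal (\<integral>v. h x v \<partial>M) \<partial>lborel)"
    by (intro nn_integral_mono ennreal_leI pointwise)
  also have "\<dots> = Q \<psi> M p s"
    unfolding Qs using h_int h_nonneg by (simp add: nn_integral_eq_integral)
  finally show "Q \<psi> M p t \<le> Q \<psi> M p s" .
qed

end
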